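(* The degree centrality $c_N=M\mathbf 1$ satisfies $c_N=(\mathbf 1^{\mathsf T}\otimes I_p)\operatorname{vec}M$, and $\hat M_n\to M$ in probability implies $\hat c_N\to c_N$ in probability. For an adjacency matrix estimator such that $\sqrt g\operatorname{vec}(\hat M_n-M)$ converges in distribution to $N(0,\Omega)$, the $i$th coefficient satisfies $$\frac{\hat c_{N,i}-c_{N,i}}{\sqrt{\sigma_{N,i}^2/g}}\ \text{ converges in distribution to }N(0,1),\qquad \sigma_{N,i}^2=(\mathbf 1\otimes e_i)^{\mathsf T}\Omega(\mathbf 1\otimes e_i).$$
   Context: $M\in\mathbb R^{p\times p}$ is a network adjacency matrix of fixed size, $\hat M_n$ an estimator of it, $\hat c_N=\hat M_n\mathbf 1$, $\mathbf 1\in\mathbb R^p$ is the vector of ones, $e_i$ is the $i$th standard basis vector of $\mathbb R^p$, $\Omega\in\mathbb R^{p^2\times p^2}$ is positive definite, and $g\in\{n,T\}$ denotes the sample size. *)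

theory Defs
  imports "HOL-Probability.Probability"
begin

(* Column-stacking vectorization: for an m x n matrix, the pair (j, i) stands for the position
   i of the j-th stacked column, i.e. the column index is the leading (block) index. *)
definition vectorize :: "real^'n^'m \<Rightarrow> real^('n \<times> 'm)" where
  "vectorize A = (\<chi> ji. A $ snd ji $ fst ji)"

(* Block convention for the Kronecker product: the left factor selects the block, so the first
   components of the row and column pairs are the block indices, as in vectorize. *)
definition kronecker :: "real^'n^'m \<Rightarrow> real^'q^'r \<Rightarrow> real^('n \<times> 'q)^('m \<times> 'r)" where
  "kronecker A B = (\<chi> ik jl. A $ fst ik $ fst jl * B $ snd ik $ snd jl)"

definition kronecker_vec :: "real^'m \<Rightarrow> real^'r \<Rightarrow> real^('m \<times> 'r)" where
  "kronecker_vec u v = (\<chi> ik. u $ fst ik * v $ snd ik)"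

lemma kronecker_vec_columnvector:
  "columnvector (kronecker_vec u v) $ ik $ (1::1) =
     kronecker (columnvector u :: real^1^'m) (columnvector v :: real^1^'r) $ ik $ (1, 1)"
  by (simp add: kronecker_vec_def kronecker_def columnvector_def)

definition pos_def_matrix :: "real^'n^'n \<Rightarrow> bool" where
  "pos_def_matrix A \<longleftrightarrow> transpose A = A \<and> (\<forall>x. x \<noteq> 0 \<longrightarrow> 0 < x \<bullet> (A *v x))"

(* Meaningful only for positive definite covariance matrices S. *)
definition mv_normal_density :: "real^'n \<Rightarrow> real^'n^'n \<Rightarrow> real^'n \<Rightarrow> real" where
  "mv_normal_density m S x =
     exp (- ((x - m) \<bullet> (matrix_inv S *v (x - m))) / 2) / sqrt ((2 * pi) ^ CARD('n) * det S)"

definition mv_normal :: "real^'n \<Rightarrow> real^'n^'n \<Rightarrow> (real^'n) measure" where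
  "mv_normal m S = density lborel (\<lambda>x. ennreal (mv_normal_density m S x))"

definition conv_in_prob ::
    "'w measure \<Rightarrow> (nat \<Rightarrow> 'w \<Rightarrow> 'a::metric_space) \<Rightarrow> 'a \<Rightarrow> bool" where
  "conv_in_prob P X c \<longleftrightarrow>
     (\<forall>\<epsilon>>0. (\<lambda>n. measure P {\<omega> \<in> space P. \<epsilon> < dist (X n \<omega>) c}) \<longlonglongrightarrow> 0)"

(* The library's weak_conv_m, defined through distribution functions, covers only measures on the
   real line; the next definition extends it to arbitrary topological spaces. *)
definition weak_conv_law :: "(nat \<Rightarrow> 'a::topological_space measure) \<Rightarrow> 'a measure \<Rightarrow> bool" where
  "weak_conv_law \<mu> \<nu> \<longleftrightarrow>
     (\<forall>f::'a \<Rightarrow> real. continuous_on UNIV f \<and> bounded (range f) \<longrightarrow>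
        (\<lambda>n. integral\<^sup>L (\<mu> n) f) \<longlonglongrightarrow> integral\<^sup>L \<nu> f)"

lemma weak_conv_law_iff_weak_conv_m:
  assumes "\<And>n. real_distribution (\<mu> n)" "real_distribution \<nu>"
  shows "weak_conv_law \<mu> \<nu> \<longleftrightarrow> weak_conv_m \<mu> \<nu>"
proof
  assume L: "weak_conv_law \<mu> \<nu>"
  show "weak_conv_m \<mu> \<nu>"
  proof (rule integral_bdd_continuous_conv_imp_weak_conv[OF assms])
    fix f :: "real \<Rightarrow> real"
    assume "\<And>x. isCont f x" "\<And>x. \<bar>f x\<bar> \<le> 1"
    then have "continuous_on UNIV f \<and> bounded (range f)"
      by (auto simp: continuous_on_eq_continuous_at bounded_iff)
    with L show "(\<lambda>n. integral\<^sup>L (\<mu> n) f) \<longlonglongrightarrow> integral\<^sup>L \<nu> f"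
      by (simp add: weak_conv_law_def)
  qed
next
  assume W: "weak_conv_m \<mu> \<nu>"
  show "weak_conv_law \<mu> \<nu>"
    unfolding weak_conv_law_def
  proof (intro allI impI)
    fix f :: "real \<Rightarrow> real"
    assume f: "continuous_on UNIV f \<and> bounded (range f)"
    then obtain B where "\<And>x. norm (f x) \<le> B"
      by (auto simp: bounded_iff)
    moreover have "\<And>x. isCont f x"
      using f by (simp add: continuous_on_eq_continuous_at)
    ultimately show "(\<lambda>n. integral\<^sup>L (\<mu> n) f) \<longlonglongrightarrow> integral\<^sup>L \<nu> f"
      using weak_conv_imp_integral_bdd_continuous_conv[OF assms W] by blast
  qed
qed

definition degree_centrality :: "real^'p^'p \<Rightarrow> real^'p" where
  "degree_centrality M = M *v 1"

definition degree_variance :: "real^('p::finite \<times> 'p)^('p \<times> 'p) \<Rightarrow> 'p \<Rightarrow> real" where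
  "degree_variance \<Omega> i =
     kronecker_vec 1 (axis i 1) \<bullet> (\<Omega> *v kronecker_vec 1 (axis i 1))"

end

theory Submission
  imports Defs
begin

text \<open>
  The degree of node \<open>i\<close> is a linear functional of the adjacency matrix, namely
  \<open>w \<bullet> vectorize A\<close> with \<open>w = kronecker_vec 1 (axis i 1)\<close>. This gives the Kronecker formula;
  consistency holds because linear maps are Lipschitz. For the limit law, the studentized degree is
  the image of \<open>sqrt g *\<^sub>R vectorize (Mhat - M)\<close> under \<open>L x = (w \<bullet> x) / sqrt (w \<bullet> (\<Omega> *v w))\<close>, so
  by continuous mapping it converges to the law of \<open>L\<close> under \<open>N(0, \<Omega>)\<close>, and it remains to
  identify that law as \<open>N(0, 1)\<close>.

  The identification rests on the translation invariance of Lebesgue measure.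
  With \<open>f\<close> the density of \<open>N(0, \<Omega>)\<close>, \<open>\<phi>\<close> the standard normal density and
  \<open>v = \<Omega> *v w / sqrt (w \<bullet> (\<Omega> *v w))\<close>, completing the square gives
  \<open>\<phi> (L x) f (x - s v) = \<phi> (L x - s) f x\<close>. Multiply by \<open>k (L x)\<close> and integrate over \<open>x\<close> and
  \<open>s\<close>. On the right, \<open>\<phi>\<close> integrates to one in \<open>s\<close>, and the integral of \<open>k \<circ> L\<close> against
  \<open>f\<close> remains. On the left, the translation \<open>x \<mapsto> x + s v\<close> raises \<open>L x\<close> by \<open>s\<close>, and
  integrating in \<open>s\<close> first leaves the product of the integral of \<open>k \<phi>\<close> and the total mass of
  \<open>f\<close> (lemma \<open>nn_integral_mv_normal_standardized\<close>). That total mass is one because weak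
  convergence of probability measures, tested against the constant function, preserves mass.
\<close>

section \<open>Standardized linear functionals of a Gaussian vector\<close>

lemma pos_def_matrix_invertible:
  fixes S :: "real^'n^'n"
  assumes "pos_def_matrix S"
  shows "invertible S"
proof -
  have "x = 0" if "S *v x = 0" for x
    using assms that unfolding pos_def_matrix_def by (metis inner_zero_right less_irrefl)
  then show ?thesis
    by (metis invertible_left_inverse matrix_left_invertible_ker)
qed

lemma
  fixes A :: "real^'n^'m"
  assumes "invertible A"
  shows matrix_inv_right: "A ** matrix_inv A = mat 1"
    and matrix_inv_left: "matrix_inv A ** A = mat 1"
  using someI_ex[OF assms[unfolded invertible_def]] by (simp_all add: matrix_inv_def)

lemma inner_matrix_inv_symmetric:
  fixes S :: "real^'n^'n"
  assumes sym: "transpose S = S" and inv: "invertible S"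
  shows "(S *v a) \<bullet> (matrix_inv S *v x) = a \<bullet> x"
    and "x \<bullet> (matrix_inv S *v (S *v a)) = a \<bullet> x"
proof -
  have "(S *v a) \<bullet> (matrix_inv S *v x) = a \<bullet> (S *v (matrix_inv S *v x))"
    by (metis dot_lmul_matrix sym transpose_matrix_vector)
  also have "\<dots> = a \<bullet> x"
    by (simp add: matrix_vector_mul_assoc matrix_inv_right[OF inv])
  finally show "(S *v a) \<bullet> (matrix_inv S *v x) = a \<bullet> x" .
  show "x \<bullet> (matrix_inv S *v (S *v a)) = a \<bullet> x"
    by (simp add: matrix_vector_mul_assoc matrix_inv_left[OF inv] inner_commute)
qed

text \<open>Completing the square: in the exponent, translating \<open>x\<close> by \<open>t *\<^sub>R (S *v w)\<close> changes the
  quadratic form of \<open>matrix_inv S\<close> only through the value \<open>w \<bullet> (x - m)\<close>.\<close>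

lemma mv_normal_density_translate:
  fixes S :: "real^'n^'n"
  assumes sym: "transpose S = S" and inv: "invertible S"
  shows "mv_normal_density m S (x - t *\<^sub>R (S *v w)) =
    exp (t * (w \<bullet> (x - m)) - t\<^sup>2 * (w \<bullet> (S *v w)) / 2) * mv_normal_density m S x"
proof -
  define y where "y = x - m"
  have *: "x - t *\<^sub>R (S *v w) - m = y - t *\<^sub>R (S *v w)"
    by (simp add: y_def)
  have "(y - t *\<^sub>R (S *v w)) \<bullet> (matrix_inv S *v (y - t *\<^sub>R (S *v w))) =
      y \<bullet> (matrix_inv S *v y) - 2 * t * (w \<bullet> y) + t\<^sup>2 * (w \<bullet> (S *v w))"
    by (simp add: matrix_vector_mult_diff_distrib matrix_vector_mult_scaleR inner_diff_left
        inner_diff_right inner_matrix_inv_symmetric[OF sym inv] power2_eq_square algebra_simps)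
  then have "exp (- ((y - t *\<^sub>R (S *v w)) \<bullet> (matrix_inv S *v (y - t *\<^sub>R (S *v w)))) / 2) =
      exp (t * (w \<bullet> y) - t\<^sup>2 * (w \<bullet> (S *v w)) / 2) * exp (- (y \<bullet> (matrix_inv S *v y)) / 2)"
    unfolding exp_add[symmetric] by (simp add: field_simps)
  then show ?thesis
    unfolding mv_normal_density_def * by (simp add: y_def)
qed

lemma borel_measurable_mv_normal_density [measurable]:
  "mv_normal_density m (S :: real^'n^'n) \<in> borel_measurable borel"
proof -
  have "continuous_on UNIV (\<lambda>x. (x - m) \<bullet> (matrix_inv S *v (x - m)))"
    by (intro continuous_intros linear_continuous_on_compose[OF _ matrix_vector_mul_linear])
  then have [measurable]: "(\<lambda>x. (x - m) \<bullet> (matrix_inv S *v (x - m))) \<in> borel_measurable borel"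
    by (rule borel_measurable_continuous_onI)
  show ?thesis
    unfolding mv_normal_density_def [abs_def] by measurable
qed

text \<open>The law of the standardized functional is the standard normal law up to a factor, because both
  \<open>f\<close> along the direction \<open>S *v w\<close> and \<open>\<phi>\<close> respond to a translation by the same exponential.
  That comparison cannot see the normalizing constant of \<open>f\<close>, so the total mass appears in the
  formula.\<close>

lemma nn_integral_mv_normal_standardized:
  fixes S :: "real^'n^'n" and k :: "real \<Rightarrow> ennreal"
  assumes sym: "transpose S = S" and inv: "invertible S" and pos: "0 < w \<bullet> (S *v w)"
    and k [measurable]: "k \<in> borel_measurable borel"
  shows "(\<integral>\<^sup>+x. k ((w \<bullet> (x - m)) / sqrt (w \<bullet> (S *v w))) \<partial>mv_normal m S) =
    emeasure (mv_normal m S) UNIV * (\<integral>\<^sup>+u. k u \<partial>std_normal_distribution)"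
proof -
  define \<sigma> where "\<sigma> = sqrt (w \<bullet> (S *v w))"
  define L where "L x = (w \<bullet> (x - m)) / \<sigma>" for x
  define v where "v = (1 / \<sigma>) *\<^sub>R (S *v w)"
  define f where "f x = ennreal (mv_normal_density m S x)" for x
  define \<phi> where "\<phi> u = ennreal (std_normal_density u)" for u
  have \<sigma>: "\<sigma> > 0" "\<sigma>\<^sup>2 = w \<bullet> (S *v w)"
    using pos by (auto simp: \<sigma>_def)
  have [measurable]: "f \<in> borel_measurable borel" "\<phi> \<in> borel_measurable borel"
      "L \<in> borel_measurable borel"
    unfolding f_def [abs_def] \<phi>_def [abs_def] L_def [abs_def] by measurable
  have L_shift: "L (x + s *\<^sub>R v) = L x + s" for x s
  proof -
    have "w \<bullet> v = \<sigma>"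
      using \<sigma> by (simp add: v_def power2_eq_square flip: \<sigma>(2))
    then have "w \<bullet> (x + s *\<^sub>R v - m) = w \<bullet> (x - m) + s * \<sigma>"
      by (simp add: inner_diff_right inner_add_right)
    then show ?thesis
      using \<sigma>(1) by (simp add: L_def add_divide_distrib)
  qed
  have exchange: "\<phi> (L x - s) * f x = \<phi> (L x) * f (x - s *\<^sub>R v)" for x s
  proof -
    have "mv_normal_density m S (x - s *\<^sub>R v) =
        exp (s * L x - s\<^sup>2 / 2) * mv_normal_density m S x"
      using mv_normal_density_translate[OF sym inv, of m x "s / \<sigma>" w] \<sigma>(1)
      by (simp add: v_def L_def power_divide flip: \<sigma>(2))
    moreover have "std_normal_density (L x) * exp (s * L x - s\<^sup>2 / 2) =
        std_normal_density (L x - s)"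
      unfolding std_normal_density_def mult.assoc exp_add[symmetric]
      by (simp add: power2_eq_square field_simps)
    ultimately have "std_normal_density (L x - s) * mv_normal_density m S x =
        std_normal_density (L x) * mv_normal_density m S (x - s *\<^sub>R v)"
      by (simp add: mult.assoc[symmetric])
    then show ?thesis
      by (simp add: f_def \<phi>_def flip: ennreal_mult')
  qed
  have mass: "(\<integral>\<^sup>+s. \<phi> (y - s) \<partial>lborel) = 1" for y
  proof -
    have "(\<integral>\<^sup>+s. \<phi> (y - s) \<partial>lborel) = (\<integral>\<^sup>+s. \<phi> s \<partial>lborel)"
      using nn_integral_real_affine[of \<phi> "-1" y] by simp
    also have "\<dots> = 1"
      using prob_space.emeasure_space_1[OF prob_space_normal_density[of 1 0]]
      by (simp add: \<phi>_def [abs_def] emeasure_density)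
    finally show ?thesis .
  qed
  have "(\<integral>\<^sup>+x. k (L x) \<partial>mv_normal m S) = (\<integral>\<^sup>+x. f x * k (L x) \<partial>lborel)"
    unfolding mv_normal_def f_def by (subst nn_integral_density) auto
  \<comment> \<open>Insert the factor \<open>1\<close> as the integral of \<open>\<phi> (L x - s)\<close> over \<open>s\<close>: averaging over all
    translates is what turns the identity \<open>exchange\<close> into a formula for the law of \<open>L\<close>.\<close>
  also have "\<dots> = (\<integral>\<^sup>+x. (\<integral>\<^sup>+s. k (L x) * (\<phi> (L x - s) * f x) \<partial>lborel) \<partial>lborel)"
    by (simp add: nn_integral_cmult nn_integral_multc mass mult.commute)
  also have "\<dots> = (\<integral>\<^sup>+x. (\<integral>\<^sup>+s. k (L x) * (\<phi> (L x) * f (x - s *\<^sub>R v)) \<partial>lborel) \<partial>lborel)"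
    by (simp only: exchange)
  also have "\<dots> = (\<integral>\<^sup>+s. (\<integral>\<^sup>+x. k (L x) * (\<phi> (L x) * f (x - s *\<^sub>R v)) \<partial>lborel) \<partial>lborel)"
    by (rule lborel_pair.Fubini') measurable
  also have "\<dots> = (\<integral>\<^sup>+s. (\<integral>\<^sup>+x. k (L x + s) * (\<phi> (L x + s) * f x) \<partial>lborel) \<partial>lborel)"
  proof (rule nn_integral_cong)
    fix s :: real
    have "(\<integral>\<^sup>+x. k (L x) * (\<phi> (L x) * f (x - s *\<^sub>R v)) \<partial>lborel) =
        (\<integral>\<^sup>+x. k (L x) * (\<phi> (L x) * f (x - s *\<^sub>R v)) \<partial>distr lborel borel ((+) (s *\<^sub>R v)))"
      by (simp add: lborel_distr_plus)
    also have "\<dots> = (\<integral>\<^sup>+x. k (L x + s) * (\<phi> (L x + s) * f x) \<partial>lborel)"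
      by (subst nn_integral_distr) (auto simp: L_shift add.commute[of "s *\<^sub>R v"])
    finally show "(\<integral>\<^sup>+x. k (L x) * (\<phi> (L x) * f (x - s *\<^sub>R v)) \<partial>lborel) =
        (\<integral>\<^sup>+x. k (L x + s) * (\<phi> (L x + s) * f x) \<partial>lborel)" .
  qed
  also have "\<dots> = (\<integral>\<^sup>+x. (\<integral>\<^sup>+s. k (L x + s) * (\<phi> (L x + s) * f x) \<partial>lborel) \<partial>lborel)"
    by (rule lborel_pair.Fubini') measurable
  also have "\<dots> = (\<integral>\<^sup>+x. f x * (\<integral>\<^sup>+u. k u * \<phi> u \<partial>lborel) \<partial>lborel)"
  proof (rule nn_integral_cong)
    fix x
    have "(\<integral>\<^sup>+s. k (L x + s) * (\<phi> (L x + s) * f x) \<partial>lborel) =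
        f x * (\<integral>\<^sup>+s. k (L x + s) * \<phi> (L x + s) \<partial>lborel)"
      by (subst nn_integral_cmult[symmetric]) (auto simp: ac_simps)
    also have "(\<integral>\<^sup>+s. k (L x + s) * \<phi> (L x + s) \<partial>lborel) = (\<integral>\<^sup>+u. k u * \<phi> u \<partial>lborel)"
      using nn_integral_real_affine[of "\<lambda>u. k u * \<phi> u" 1 "L x"] by simp
    finally show "(\<integral>\<^sup>+s. k (L x + s) * (\<phi> (L x + s) * f x) \<partial>lborel) =
        f x * (\<integral>\<^sup>+u. k u * \<phi> u \<partial>lborel)" .
  qed
  also have "\<dots> = (\<integral>\<^sup>+x. f x \<partial>lborel) * (\<integral>\<^sup>+u. k u * \<phi> u \<partial>lborel)"
    by (rule nn_integral_multc) measurable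
  also have "(\<integral>\<^sup>+x. f x \<partial>lborel) = emeasure (mv_normal m S) UNIV"
    by (simp add: mv_normal_def f_def [abs_def] emeasure_density)
  also have "(\<integral>\<^sup>+u. k u * \<phi> u \<partial>lborel) = (\<integral>\<^sup>+u. k u \<partial>std_normal_distribution)"
    by (subst nn_integral_density) (auto simp: \<phi>_def mult.commute)
  finally show ?thesis
    by (simp add: L_def \<sigma>_def)
qed

lemma sets_mv_normal [measurable_cong, simp]: "sets (mv_normal m S) = sets borel"
  by (simp add: mv_normal_def)

lemma distr_mv_normal_standardized:
  fixes S :: "real^'n^'n"
  assumes S: "pos_def_matrix S" and w: "w \<noteq> 0"
    and mass: "emeasure (mv_normal m S) UNIV = 1"
  shows "distr (mv_normal m S) borel (\<lambda>x. (w \<bullet> (x - m)) / sqrt (w \<bullet> (S *v w))) =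
    std_normal_distribution"
proof (rule measure_eqI)
  fix A assume "A \<in> sets (distr (mv_normal m S) borel (\<lambda>x. (w \<bullet> (x - m)) / sqrt (w \<bullet> (S *v w))))"
  then have A [measurable]: "A \<in> sets borel"
    by simp
  let ?L = "\<lambda>x. (w \<bullet> (x - m)) / sqrt (w \<bullet> (S *v w))"
  let ?D = "distr (mv_normal m S) borel ?L"
  have "emeasure ?D A = (\<integral>\<^sup>+u. indicator A u \<partial>?D)"
    by simp
  also have "\<dots> = (\<integral>\<^sup>+x. indicator A (?L x) \<partial>mv_normal m S)"
    by (rule nn_integral_distr) measurable
  also have "\<dots> = (\<integral>\<^sup>+u. indicator A u \<partial>std_normal_distribution)"
    using S w nn_integral_mv_normal_standardized[of S w "indicator A" m]
    by (simp add: mass pos_def_matrix_invertible pos_def_matrix_def)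
  finally show "emeasure ?D A = emeasure std_normal_distribution A"
    by simp
qed simp

section \<open>Images of convergent sequences\<close>

text \<open>Applied to a sequence of laws converging to \<open>mv_normal\<close>, this shows that the Gaussian density
  integrates to one.\<close>

lemma weak_conv_law_mass:
  assumes "weak_conv_law \<mu> \<nu>" and "\<And>n. prob_space (\<mu> n)"
  shows "emeasure \<nu> (space \<nu>) = 1"
proof -
  have "(\<lambda>n. \<integral>x. 1 \<partial>\<mu> n) \<longlonglongrightarrow> (\<integral>x. (1::real) \<partial>\<nu>)"
    using assms(1)[unfolded weak_conv_law_def, rule_format, of "\<lambda>_. 1"]
    by (simp add: image_constant_conv)
  then have "(\<lambda>n. 1) \<longlonglongrightarrow> measure \<nu> (space \<nu>)"
    by (simp add: prob_space.prob_space[OF assms(2)])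
  then have "measure \<nu> (space \<nu>) = 1"
    by (simp add: LIMSEQ_const_iff)
  then show ?thesis
    by (simp add: measure_def)
qed

lemma weak_conv_law_distr:
  fixes h :: "'a::topological_space \<Rightarrow> 'b::topological_space"
  assumes conv: "weak_conv_law \<mu> \<nu>" and h: "continuous_on UNIV h"
    and sets: "\<And>n. sets (\<mu> n) = sets borel" "sets \<nu> = sets borel"
  shows "weak_conv_law (\<lambda>n. distr (\<mu> n) borel h) (distr \<nu> borel h)"
  unfolding weak_conv_law_def
proof (intro allI impI)
  fix f :: "'b \<Rightarrow> real"
  assume f: "continuous_on UNIV f \<and> bounded (range f)"
  have [measurable]: "h \<in> borel_measurable borel" "f \<in> borel_measurable borel"
    using h f by (auto intro: borel_measurable_continuous_onI)
  note sets [measurable_cong]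
  have "continuous_on UNIV (\<lambda>x. f (h x))"
    using f h by (metis continuous_on_compose2 subset_UNIV)
  moreover have "bounded (range (\<lambda>x. f (h x)))"
    using f by (auto intro: bounded_subset)
  ultimately show "(\<lambda>n. integral\<^sup>L (distr (\<mu> n) borel h) f) \<longlonglongrightarrow>
      integral\<^sup>L (distr \<nu> borel h) f"
    using conv by (simp add: integral_distr weak_conv_law_def)
qed

lemma conv_in_prob_bounded_linear:
  fixes F :: "'a::{real_normed_vector, second_countable_topology} \<Rightarrow> 'b::real_normed_vector"
  assumes P: "prob_space P" and X [measurable]: "\<And>n. X n \<in> borel_measurable P"
    and F: "bounded_linear F" and conv: "conv_in_prob P X c"
  shows "conv_in_prob P (\<lambda>n \<omega>. F (X n \<omega>)) (F c)"
  unfolding conv_in_prob_def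
proof (intro allI impI)
  fix \<epsilon> :: real assume "\<epsilon> > 0"
  interpret prob_space P by fact
  obtain K where K: "K > 0" "\<And>x. norm (F x) \<le> norm x * K"
    using bounded_linear.pos_bounded[OF F] by blast
  have sub: "{\<omega> \<in> space P. \<epsilon> < dist (F (X n \<omega>)) (F c)} \<subseteq>
      {\<omega> \<in> space P. \<epsilon> / K < dist (X n \<omega>) c}" for n
  proof safe
    fix \<omega> assume "\<epsilon> < dist (F (X n \<omega>)) (F c)"
    also have "\<dots> = norm (F (X n \<omega> - c))"
      by (simp add: dist_norm linear_diff bounded_linear.linear[OF F])
    also have "\<dots> \<le> dist (X n \<omega>) c * K"
      using K(2) by (simp add: dist_norm)
    finally show "\<epsilon> / K < dist (X n \<omega>) c"
      using K(1) by (simp add: divide_less_eq)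
  qed
  have "(\<lambda>n. prob {\<omega> \<in> space P. \<epsilon> / K < dist (X n \<omega>) c}) \<longlonglongrightarrow> 0"
    using conv \<open>\<epsilon> > 0\<close> K(1) by (simp add: conv_in_prob_def)
  then show "(\<lambda>n. prob {\<omega> \<in> space P. \<epsilon> < dist (F (X n \<omega>)) (F c)}) \<longlonglongrightarrow> 0"
    by (rule tendsto_sandwich[OF _ _ tendsto_const, rotated 2])
      (auto intro!: always_eventually finite_measure_mono sub)
qed

section \<open>Degree centrality\<close>

lemma sum_UNIV_prod:
  fixes f :: "'a::finite \<times> 'b::finite \<Rightarrow> real"
  shows "sum f UNIV = (\<Sum>j\<in>UNIV. \<Sum>i\<in>UNIV. f (j, i))"
  unfolding UNIV_Times_UNIV[symmetric] by (simp add: sum.cartesian_product del: UNIV_Times_UNIV)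

lemma degree_centrality_nth: "degree_centrality A $ i = (\<Sum>j\<in>UNIV. A $ i $ j)"
  by (simp add: degree_centrality_def matrix_vector_mult_def)

lemma degree_centrality_kronecker:
  "degree_centrality (A :: real^'p^'p) $ i =
    (kronecker (rowvector 1 :: real^'p^1) (mat 1 :: real^'p^'p) *v vectorize A) $ (1, i)"
  by (simp add: degree_centrality_nth matrix_vector_mult_def sum_UNIV_prod kronecker_def
      vectorize_def rowvector_def mat_def if_distrib if_distribR cong: if_cong)

lemma degree_centrality_inner:
  "degree_centrality A $ i = kronecker_vec 1 (axis i 1) \<bullet> vectorize A"
  by (simp add: degree_centrality_nth inner_vec_def sum_UNIV_prod kronecker_vec_def
      vectorize_def axis_def if_distrib if_distribR cong: if_cong)

lemma kronecker_vec_one_axis_nonzero: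
  "kronecker_vec (1 :: real^'m) (axis i 1 :: real^'r) \<noteq> 0"
proof
  assume "kronecker_vec (1 :: real^'m) (axis i 1 :: real^'r) = 0"
  then have "kronecker_vec (1 :: real^'m) (axis i 1 :: real^'r) $ (undefined, i) = 0"
    by simp
  then show False
    by (simp add: kronecker_vec_def)
qed

lemma bounded_linear_degree_centrality: "bounded_linear degree_centrality"
  unfolding linear_conv_bounded_linear [symmetric]
  by (rule linearI)
    (simp_all add: vec_eq_iff degree_centrality_nth sum.distrib sum_distrib_left)

lemma bounded_linear_vectorize: "bounded_linear (vectorize :: real^'n^'m \<Rightarrow> _)"
  unfolding linear_conv_bounded_linear [symmetric]
  by (rule linearI) (simp_all add: vec_eq_iff vectorize_def)

text \<open>For \<open>s = 0\<close> both sides vanish because division by zero yields zero, so the sample size may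
  be zero here.\<close>

lemma studentized_degree_eq:
  fixes \<Omega> :: "real^('p::finite \<times> 'p)^('p \<times> 'p)" and s :: nat
  defines "w i \<equiv> kronecker_vec 1 (axis i 1)"
  shows "(degree_centrality A $ i - degree_centrality B $ i) / sqrt (degree_variance \<Omega> i / real s) =
    (w i \<bullet> (sqrt (real s) *\<^sub>R vectorize (A - B))) / sqrt (w i \<bullet> (\<Omega> *v w i))"
proof -
  have "w i \<bullet> vectorize (A - B) = degree_centrality A $ i - degree_centrality B $ i"
    by (simp add: w_def linear_diff bounded_linear.linear[OF bounded_linear_degree_centrality]
        flip: degree_centrality_inner)
  then show ?thesis
    by (simp add: degree_variance_def w_def real_sqrt_divide)
qed

theorem theorem11:
  fixes P :: "'w measure"
    and M :: "real^'p^'p"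
    and Mhat :: "nat \<Rightarrow> 'w \<Rightarrow> real^'p^'p"
    and \<Omega> :: "real^('p \<times> 'p)^('p \<times> 'p)"
    and g :: "nat \<Rightarrow> nat"
  assumes "prob_space P"
    and "\<And>n. Mhat n \<in> borel_measurable P"
    and "pos_def_matrix \<Omega>"
    and "filterlim g at_top sequentially"
  shows "degree_centrality M =
           (\<chi> i. (kronecker (rowvector 1 :: real^'p^1) (mat 1 :: real^'p^'p) *v vectorize M) $ (1, i))
       \<and> (conv_in_prob P Mhat M \<longrightarrow>
           conv_in_prob P (\<lambda>n \<omega>. degree_centrality (Mhat n \<omega>)) (degree_centrality M))
       \<and> (weak_conv_law
             (\<lambda>n. distr P borel (\<lambda>\<omega>. sqrt (real (g n)) *\<^sub>R vectorize (Mhat n \<omega> - M)))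
             (mv_normal 0 \<Omega>) \<longrightarrow>
           (\<forall>i. weak_conv_m
             (\<lambda>n. distr P borel
                (\<lambda>\<omega>. (degree_centrality (Mhat n \<omega>) $ i - degree_centrality M $ i)
                        / sqrt (degree_variance \<Omega> i / real (g n))))
             std_normal_distribution))"
proof (intro conjI impI allI)
  interpret prob_space P by fact
  show "degree_centrality M =
      (\<chi> i. (kronecker (rowvector 1 :: real^'p^1) (mat 1 :: real^'p^'p) *v vectorize M) $ (1, i))"
    by (simp add: vec_eq_iff flip: degree_centrality_kronecker)
  show "conv_in_prob P (\<lambda>n \<omega>. degree_centrality (Mhat n \<omega>)) (degree_centrality M)"
    if "conv_in_prob P Mhat M"
    using conv_in_prob_bounded_linear[OF assms(1,2) bounded_linear_degree_centrality that] .
  fix i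
  let ?X = "\<lambda>n \<omega>. sqrt (real (g n)) *\<^sub>R vectorize (Mhat n \<omega> - M)"
  let ?Z = "\<lambda>n \<omega>. (degree_centrality (Mhat n \<omega>) $ i - degree_centrality M $ i)
                    / sqrt (degree_variance \<Omega> i / real (g n))"
  assume conv: "weak_conv_law (\<lambda>n. distr P borel (?X n)) (mv_normal 0 \<Omega>)"
  define w :: "real^('p \<times> 'p)" where "w = kronecker_vec 1 (axis i 1)"
  define L where "L x = (w \<bullet> x) / sqrt (w \<bullet> (\<Omega> *v w))" for x
  have "w \<noteq> 0"
    by (simp add: w_def kronecker_vec_one_axis_nonzero)
  have L: "continuous_on UNIV L"
    unfolding L_def [abs_def] divide_inverse by (intro continuous_intros)
  have [measurable]: "L \<in> borel_measurable borel"
    using L by (rule borel_measurable_continuous_onI)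
  note assms(2) [measurable]
  have [measurable]: "vectorize \<in> borel_measurable (borel :: (real^'p^'p) measure)"
    by (intro borel_measurable_continuous_onI linear_continuous_on bounded_linear_vectorize)
  have X [measurable]: "?X n \<in> borel_measurable P" for n
    by measurable
  have Z: "?Z n = (\<lambda>\<omega>. L (?X n \<omega>))" for n
    unfolding studentized_degree_eq by (simp add: L_def w_def)
  have "emeasure (mv_normal 0 \<Omega>) UNIV = 1"
    using weak_conv_law_mass[OF conv] by (simp add: prob_space_distr X mv_normal_def)
  then have limit: "distr (mv_normal 0 \<Omega>) borel L = std_normal_distribution"
    using distr_mv_normal_standardized[OF assms(3) \<open>w \<noteq> 0\<close>, of 0]
    by (simp add: L_def [abs_def])
  have "distr (distr P borel (?X n)) borel L = distr P borel (?Z n)" for n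
    unfolding Z by (subst distr_distr) (auto simp: comp_def)
  then have "weak_conv_law (\<lambda>n. distr P borel (?Z n)) std_normal_distribution"
    using weak_conv_law_distr[OF conv L] by (simp add: limit)
  moreover have "real_distribution (distr P borel (?Z n))" for n
    unfolding Z by (rule real_distribution_distr) measurable
  ultimately show "weak_conv_m (\<lambda>n. distr P borel (?Z n)) std_normal_distribution"
    by (subst weak_conv_law_iff_weak_conv_m[symmetric]) (auto intro: real_dist_normal_dist)
qed

end
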